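(* Let $N\ge 1$, let $c_1,\dots,c_N\in\mathbb{C}$, and let $L$ be the differential operator $$L=\sum_{i=1}^N c_i x^{i-1}\partial_x^{i}+x\partial_x .$$ Let $\{P_n\}_{n\ge 0}$ be the sequence of monic eigenpolynomials of $L$, $\deg P_n=n$, with corresponding sequence of eigenvalues $\{\lambda_n\}$, that is, $LP_n=\lambda_nP_n$ for all $n\ge 0$. Then the following recurrence relation is satisfied: $$\sum_{s=1}^{N-1}\alpha_{n,n-s}P_{n-s}(x)+(\alpha_{n,n}-x)P_n(x)+P_{n+1}(x)=0,\qquad n=0,1,2,\ldots,$$ $$P_{-N+1}=P_{-N+2}=\cdots=P_{-1}=0,\qquad P_0=1,$$ where $$\alpha_{n,n-s}=\frac{\delta^{(1)}_n\delta^{(1)}_{n-1}\cdots\delta^{(1)}_{n-s+1}}{(s+1)!}\sum_{j=0}^{s+1}\binom{s+1}{j}(-1)^j\delta^{(1)}_{n-s+j},\qquad s=0,\ldots,N-1,$$ with the product $\delta^{(1)}_n\delta^{(1)}_{n-1}\cdots\delta^{(1)}_{n-s+1}$ understood as $1$ when $s=0$, and with $\alpha_{n,n-s}=0$ when $n-s<0$.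
   Context: Here $\partial_x^i$ denotes the $i$-th derivative with respect to $x$. The numbers $\delta_n^{(1)}$ are defined by $$\delta_n^{(1)}=\sum_{s=1}^n\binom{n}{s}s!\,c_s,\qquad n=0,1,2,\dots,$$ where $c_s=0$ for $s>N$ (so $\delta_0^{(1)}=0$). They are the case $k=1$ of the general definition $\delta_n^{(k)}=\sum_{i=k}^n\binom{n}{i}i!\,a_{i,i-k}$ for an operator $\sum_i a_i(x)\partial_x^i$ with $a_i(x)=\sum_{j=0}^i a_{i,j}x^j$. *)

theory Defs
  imports Complex_Main "HOL-Computational_Algebra.Polynomial"
begin

definition diff_op :: "nat \<Rightarrow> (nat \<Rightarrow> complex) \<Rightarrow> complex poly \<Rightarrow> complex poly" where
  "diff_op N c p =
     (\<Sum>i=1..N. smult (c i) (monom 1 (i - 1) * (pderiv ^^ i) p)) + monom 1 1 * pderiv p"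

(* Only c 1, ..., c N are coefficients of the operator; the other values of c are
   replaced by 0. *)
definition delta1 :: "nat \<Rightarrow> (nat \<Rightarrow> complex) \<Rightarrow> nat \<Rightarrow> complex" where
  "delta1 N c n =
     (\<Sum>s=1..n. of_nat (n choose s) * fact s * (if s \<le> N then c s else 0))"

(* alpha N c n s is the coefficient with double index (n, n - s): the second argument is
   the offset s. In the branch s \<le> n the subtractions on nat are exact. *)
definition alpha :: "nat \<Rightarrow> (nat \<Rightarrow> complex) \<Rightarrow> nat \<Rightarrow> nat \<Rightarrow> complex" where
  "alpha N c n s =
     (if s \<le> n
      then (\<Prod>i<s. delta1 N c (n - i)) / fact (s + 1) *
           (\<Sum>j=0..s + 1. of_nat ((s + 1) choose j) * (-1) ^ j * delta1 N c (n - s + j))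
      else 0)"

definition extend_by_zero :: "(nat \<Rightarrow> complex poly) \<Rightarrow> int \<Rightarrow> complex poly" where
  "extend_by_zero P m = (if m < 0 then 0 else P (nat m))"

end

theory Submission
  imports Defs
begin

text \<open>
  Write \<open>\<delta>\<^sub>n\<close> for \<open>delta1 N c n\<close>, and let \<open>D\<close> be the linear map with \<open>D x\<^sup>n = \<delta>\<^sub>n x\<^sup>n\<^sup>-\<^sup>1\<close>
  (so \<open>D 1 = 0\<close>). Since \<open>x\<^sup>i\<^sup>-\<^sup>1 \<partial>\<^sup>i x\<^sup>n = i! (n choose i) x\<^sup>n\<^sup>-\<^sup>1\<close>, the operator is
  \<open>L = E + D\<close> with \<open>E = x \<partial>\<close>. As \<open>[D, E] = D\<close>, this means \<open>L = e\<^sup>D E e\<^sup>-\<^sup>D\<close>, and hence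
  \<open>P\<^sub>n = e\<^sup>D x\<^sup>n = \<Sum>\<^sub>k \<delta>\<^sub>n \<delta>\<^sub>n\<^sub>-\<^sub>1 \<dots> \<delta>\<^sub>n\<^sub>-\<^sub>k\<^sub>+\<^sub>1 / k! x\<^sup>n\<^sup>-\<^sup>k\<close> with eigenvalue \<open>n\<close>.

  Consequently \<open>x P\<^sub>n = e\<^sup>D (e\<^sup>-\<^sup>D x e\<^sup>D) x\<^sup>n\<close>, where \<open>e\<^sup>-\<^sup>D x e\<^sup>D\<close> is the sum over \<open>k\<close> of
  \<open>(-1)\<^sup>k / k!\<close> times the \<open>k\<close>-fold commutator of \<open>D\<close> with multiplication by \<open>x\<close>. For
  \<open>k \<ge> 1\<close> that commutator sends \<open>x\<^sup>n\<close> to a multiple of \<open>x\<^sup>n\<^sup>+\<^sup>1\<^sup>-\<^sup>k\<close>, whose factor is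
  \<open>\<delta>\<^sub>n \<dots> \<delta>\<^sub>n\<^sub>-\<^sub>k\<^sub>+\<^sub>2\<close> times a \<open>k\<close>-th difference of the sequence \<open>\<delta>\<close>. Applying
  \<open>e\<^sup>D\<close> turns the powers of \<open>x\<close> back into the \<open>P\<^sub>n\<^sub>+\<^sub>1\<^sub>-\<^sub>k\<close>; with \<open>k = s + 1\<close> this is the
  recurrence, with all offsets \<open>s \<le> n\<close> present. It stops at \<open>s = N - 1\<close> because \<open>\<delta>\<^sub>n\<close> is
  a polynomial in \<open>n\<close> of degree at most \<open>N\<close>, so its differences of order above \<open>N\<close> vanish
  (\<open>altdiff_delta1\<close>).

  The proof carries this out on coefficients. The formula for \<open>P\<^sub>n\<close> comes from solving
  the eigenvalue equation downwards from the leading coefficient (\<open>eigenpoly_coeff\<close>), and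
  the commutator expansion becomes Newton's interpolation formula for the sequence
  \<open>\<delta>\<close> (\<open>Newton_backward\<close>, \<open>recurrence_coeff\<close>).
\<close>

section \<open>Alternating differences and Newton interpolation\<close>

text \<open>
  This is \<open>((I - S)\<^sup>k f) a\<close> for the shift \<open>S\<close>, that is, \<open>(-1)\<^sup>k\<close> times the usual forward
  difference; the sign is the one that occurs in \<open>alpha\<close>.
\<close>
definition altdiff :: "nat \<Rightarrow> (nat \<Rightarrow> 'a::comm_ring_1) \<Rightarrow> nat \<Rightarrow> 'a" where
  "altdiff k f a = (\<Sum>j\<le>k. of_nat (k choose j) * (-1) ^ j * f (a + j))"

lemma altdiff_0 [simp]: "altdiff 0 f a = f a"
  by (simp add: altdiff_def)

lemma sum_Pascal:
  fixes g :: "nat \<Rightarrow> 'a::comm_ring_1"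
  shows "(\<Sum>k\<le>Suc m. of_nat (Suc m choose k) * g k) =
         (\<Sum>k\<le>m. of_nat (m choose k) * g k) + (\<Sum>k\<le>m. of_nat (m choose k) * g (Suc k))"
proof -
  have "(\<Sum>k\<le>Suc m. of_nat (Suc m choose k) * g k) =
        g 0 + (\<Sum>k\<le>m. of_nat (Suc m choose Suc k) * g (Suc k))"
    by (subst sum.atMost_Suc_shift) simp
  also have "\<dots> = (g 0 + (\<Sum>k\<le>m. of_nat (m choose Suc k) * g (Suc k)))
                  + (\<Sum>k\<le>m. of_nat (m choose k) * g (Suc k))"
    by (simp add: algebra_simps sum.distrib)
  also have "g 0 + (\<Sum>k\<le>m. of_nat (m choose Suc k) * g (Suc k)) =
             (\<Sum>k\<le>Suc m. of_nat (m choose k) * g k)"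
    by (subst sum.atMost_Suc_shift) simp
  also have "\<dots> = (\<Sum>k\<le>m. of_nat (m choose k) * g k)"
    by (simp add: binomial_eq_0)
  finally show ?thesis .
qed

lemma altdiff_Suc: "altdiff (Suc k) f a = altdiff k f a - altdiff k f (Suc a)"
  using sum_Pascal[of k "\<lambda>j. (-1) ^ j * f (a + j)"]
  by (simp add: altdiff_def mult.assoc sum_negf)

lemma altdiff_Suc_fun: "altdiff (Suc k) f a = altdiff k (\<lambda>n. f n - f (Suc n)) a"
  unfolding altdiff_Suc by (simp add: altdiff_def algebra_simps sum_subtractf)

lemma altdiff_sum:
  "altdiff k (\<lambda>n. \<Sum>i\<in>A. w i * f i n) a = (\<Sum>i\<in>A. w i * altdiff k (f i) a)"
  unfolding altdiff_def sum_distrib_left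
  by (subst sum.swap) (simp add: mult_ac)

lemma altdiff_minus: "altdiff k (\<lambda>n. - f n) a = - altdiff k f a"
  by (simp add: altdiff_def sum_negf)

text \<open>
  By Pascal's rule, one difference turns \<open>n choose s\<close> into \<open>- (n choose (s - 1))\<close>, so
  \<open>s + 1\<close> differences annihilate it.
\<close>
lemma altdiff_binomial:
  "s < k \<Longrightarrow> altdiff k (\<lambda>n. of_nat (n choose s)) a = 0"
proof (induction k arbitrary: s)
  case (Suc k)
  show ?case
  proof (cases s)
    case 0
    then show ?thesis by (simp add: altdiff_Suc_fun) (simp add: altdiff_def)
  next
    case (Suc t)
    then show ?thesis
      using Suc.IH[of t] Suc.prems by (simp add: altdiff_Suc_fun altdiff_minus)
  qed
qed simp

text \<open>
  Expanding \<open>I = (S + (I - S))\<^sup>m\<close> by the binomial theorem expresses \<open>f a\<close> by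
  differences of \<open>f\<close> at the points \<open>a, \<dots>, a + m\<close>.
\<close>
lemma Newton_backward:
  "f a = (\<Sum>k\<le>m. of_nat (m choose k) * altdiff k f (a + m - k))"
proof (induction m)
  case (Suc m)
  have "f a = (\<Sum>k\<le>m. of_nat (m choose k) *
                (altdiff k f (a + Suc m - k) + altdiff (Suc k) f (a + Suc m - Suc k)))"
    by (subst Suc) (auto intro!: sum.cong simp: altdiff_Suc Suc_diff_le)
  also have "\<dots> = (\<Sum>k\<le>Suc m. of_nat (Suc m choose k) * altdiff k f (a + Suc m - k))"
    unfolding sum_Pascal by (simp only: distrib_left sum.distrib)
  finally show ?case .
qed simp

section \<open>The eigenpolynomials\<close>

text \<open>
  Since \<open>n choose s\<close> is \<open>0\<close> for \<open>s > n\<close>, the range of summation can be made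
  independent of \<open>n\<close>. This shows that \<open>delta1 N c\<close> is polynomial of degree at most \<open>N\<close>.
\<close>
lemma delta1_eq_fixed_sum:
  "delta1 N c n = (\<Sum>s=1..N. (fact s * c s) * of_nat (n choose s))"
proof -
  have "delta1 N c n =
        (\<Sum>s\<in>{1..max n N}. of_nat (n choose s) * fact s * (if s \<le> N then c s else 0))"
    unfolding delta1_def by (rule sum.mono_neutral_left) auto
  also have "\<dots> = (\<Sum>s\<in>{1..N}. of_nat (n choose s) * fact s * (if s \<le> N then c s else 0))"
    by (rule sum.mono_neutral_right) auto
  also have "\<dots> = (\<Sum>s=1..N. (fact s * c s) * of_nat (n choose s))"
    by (rule sum.cong) auto
  finally show ?thesis .
qed

lemma delta1_0 [simp]: "delta1 N c 0 = 0"
  by (simp add: delta1_def)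

lemma altdiff_delta1: "N < k \<Longrightarrow> altdiff k (delta1 N c) a = 0"
  unfolding delta1_eq_fixed_sum[abs_def] altdiff_sum
  by (rule sum.neutral) (auto simp: altdiff_binomial)

text \<open>
  The coefficient form of \<open>L = E + D\<close>: each \<open>x\<^sup>i\<^sup>-\<^sup>1 \<partial>\<^sup>i\<close> lowers the degree by exactly one,
  so the eigenvalue equation links only neighbouring coefficients.
\<close>
lemma coeff_diff_op:
  "coeff (diff_op N c p) m = of_nat m * coeff p m + delta1 N c (Suc m) * coeff p (Suc m)"
proof -
  have summand: "coeff (monom 1 (i - 1) * (pderiv ^^ i) p) m =
        fact i * of_nat (Suc m choose i) * coeff p (Suc m)" if i: "i \<ge> 1" for i
  proof (cases "i \<le> Suc m")
    case True
    then obtain k where k: "Suc m = k + i"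
      by (metis le_add_diff_inverse2)
    have "m - (i - 1) = k" using k i by simp
    moreover have "pochhammer (of_nat (Suc k) :: complex) i = fact i * of_nat (Suc m choose i)"
    proof -
      have "(fact (Suc m) :: complex) = fact k * pochhammer (of_nat (Suc k)) i"
        using pochhammer_product'[of "1 :: complex" k i] k
        by (simp add: pochhammer_fact del: fact_Suc)
      then show ?thesis
        using k True by (simp add: binomial_fact del: fact_Suc)
    qed
    ultimately show ?thesis
      using True i k by (simp add: coeff_monom_mult coeff_higher_pderiv)
  qed (use i in \<open>auto simp: coeff_monom_mult\<close>)
  have "coeff (monom 1 1 * pderiv p) m = of_nat m * coeff p m"
    by (cases m) (simp_all add: coeff_monom_mult coeff_pderiv)
  moreover have "(\<Sum>i=1..N. c i * coeff (monom 1 (i - 1) * (pderiv ^^ i) p) m) =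
        delta1 N c (Suc m) * coeff p (Suc m)"
    unfolding delta1_eq_fixed_sum sum_distrib_right
    by (rule sum.cong[OF refl], subst summand) auto
  ultimately show ?thesis
    by (simp add: diff_op_def coeff_sum)
qed

text \<open>The factor in \<open>D\<^sup>k x\<^sup>n = delta_falling N c n k \<cdot> x\<^sup>n\<^sup>-\<^sup>k\<close>.\<close>
definition delta_falling :: "nat \<Rightarrow> (nat \<Rightarrow> complex) \<Rightarrow> nat \<Rightarrow> nat \<Rightarrow> complex" where
  "delta_falling N c n k = (\<Prod>i<k. delta1 N c (n - i))"

lemma delta_falling_0 [simp]: "delta_falling N c n 0 = 1"
  by (simp add: delta_falling_def)

lemma delta_falling_Suc:
  "delta_falling N c n (Suc k) = delta_falling N c n k * delta1 N c (n - k)"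
  by (simp add: delta_falling_def)

lemma delta_falling_Suc_left:
  "delta_falling N c (Suc n) (Suc k) = delta1 N c (Suc n) * delta_falling N c n k"
  unfolding delta_falling_def by (subst prod.lessThan_Suc_shift) simp

lemma delta_falling_add:
  "delta_falling N c n (j + k) = delta_falling N c n j * delta_falling N c (n - j) k"
  by (induction k) (simp_all add: delta_falling_Suc)

text \<open>
  So \<open>alpha N c n s\<close> is \<open>(-1)\<^sup>k / k!\<close> times the factor of the \<open>k\<close>-fold commutator of \<open>D\<close>
  with multiplication by \<open>x\<close>, applied to \<open>x\<^sup>n\<close>, where \<open>k = s + 1\<close>.
\<close>
lemma alpha_altdiff:
  "s \<le> n \<Longrightarrow> alpha N c n s =
     delta_falling N c n s / fact (Suc s) * altdiff (Suc s) (delta1 N c) (n - s)"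
  by (simp add: alpha_def delta_falling_def altdiff_def atLeast0AtMost)

text \<open>
  Comparing coefficients of \<open>x\<^sup>n\<close> gives the eigenvalue \<open>n\<close>, and those of \<open>x\<^sup>m\<close> then give
  \<open>(n - m) p\<^sub>m = \<delta>\<^sub>m\<^sub>+\<^sub>1 p\<^sub>m\<^sub>+\<^sub>1\<close>, which determines all coefficients from the leading one.
\<close>
lemma eigenpoly_coeff:
  fixes p :: "complex poly"
  assumes "degree p = n" "lead_coeff p = 1" "diff_op N c p = smult l p"
  shows "k \<le> n \<Longrightarrow> coeff p (n - k) = delta_falling N c n k / fact k"
proof (induction k)
  case (Suc k)
  have eq: "of_nat m * coeff p m + delta1 N c (Suc m) * coeff p (Suc m) = l * coeff p m" for m
    using coeff_diff_op[of N c p m] assms(3) by simp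
  have l: "l = of_nat n"
    using eq[of n] assms(1,2) by (simp add: coeff_eq_0)
  define m where "m = n - Suc k"
  have m: "Suc m = n - k" "n = Suc k + m" using Suc.prems by (auto simp: m_def)
  have "of_nat (Suc k) * coeff p m = delta1 N c (n - k) * coeff p (n - k)"
  proof -
    have "(of_nat n :: complex) = of_nat (Suc k) + of_nat m"
      using m(2) of_nat_add by metis
    then show ?thesis
      using eq[of m] unfolding l m(1) by (simp add: algebra_simps)
  qed
  also have "\<dots> = delta_falling N c n (Suc k) / fact k"
    using Suc by (simp add: delta_falling_Suc)
  finally show ?case
    by (simp add: m_def field_simps del: of_nat_Suc)
qed (use assms in simp)

section \<open>The recurrence\<close>

text \<open>
  This is the recurrence read off at \<open>x\<^sup>n\<^sup>-\<^sup>m\<close>. All its terms share the factor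
  \<open>\<delta>\<^sub>n \<dots> \<delta>\<^sub>n\<^sub>-\<^sub>m\<^sub>+\<^sub>1 / (m + 1)!\<close>, because the product in \<open>alpha N c n s\<close> is continued by the
  one in the coefficient of \<open>P\<^sub>n\<^sub>-\<^sub>s\<close>. What remains is Newton's formula for \<open>\<delta>\<^sub>n\<^sub>-\<^sub>m\<close>.
\<close>
lemma recurrence_coeff:
  assumes "m \<le> n"
  shows "delta_falling N c n (Suc m) / fact (Suc m) =
     delta_falling N c (Suc n) (Suc m) / fact (Suc m) +
     (\<Sum>s\<le>m. alpha N c n s * (delta_falling N c (n - s) (m - s) / fact (m - s)))"
proof -
  let ?F = "delta_falling N c n m"
  let ?D = "\<lambda>k. altdiff k (delta1 N c) (Suc n - k)"
  have summand: "alpha N c n s * (delta_falling N c (n - s) (m - s) / fact (m - s)) =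
      ?F / fact (Suc m) * (of_nat (Suc m choose Suc s) * ?D (Suc s))" if s: "s \<le> m" for s
  proof -
    have "delta_falling N c n s * delta_falling N c (n - s) (m - s) = ?F"
      using delta_falling_add[of N c n s "m - s"] s by simp
    moreover have "(of_nat (Suc m choose Suc s) :: complex) =
        fact (Suc m) / (fact (Suc s) * fact (m - s))"
      using s by (subst binomial_fact) auto
    moreover have "?D (Suc s) = altdiff (Suc s) (delta1 N c) (n - s)" by simp
    ultimately show ?thesis
      using s assms by (simp add: alpha_altdiff del: fact_Suc)
  qed
  have "delta1 N c (n - m) = (\<Sum>k\<le>Suc m. of_nat (Suc m choose k) * ?D k)"
    using Newton_backward[of "delta1 N c" "n - m" "Suc m"] assms by simp
  also have "\<dots> = delta1 N c (Suc n) + (\<Sum>s\<le>m. of_nat (Suc m choose Suc s) * ?D (Suc s))"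
    by (subst sum.atMost_Suc_shift) simp
  finally have "?F / fact (Suc m) * delta1 N c (n - m) = ?F / fact (Suc m) * delta1 N c (Suc n)
     + (\<Sum>s\<le>m. ?F / fact (Suc m) * (of_nat (Suc m choose Suc s) * ?D (Suc s)))"
    by (simp only: distrib_left sum_distrib_left)
  also have "(\<Sum>s\<le>m. ?F / fact (Suc m) * (of_nat (Suc m choose Suc s) * ?D (Suc s))) =
      (\<Sum>s\<le>m. alpha N c n s * (delta_falling N c (n - s) (m - s) / fact (m - s)))"
    by (rule sum.cong) (simp_all only: summand atMost_iff)
  finally show ?thesis
    unfolding delta_falling_Suc_left
    unfolding delta_falling_Suc by (simp only: times_divide_eq_right mult.commute)
qed

text \<open>
  The expansion of \<open>x P\<^sub>n = e\<^sup>D (e\<^sup>-\<^sup>D x e\<^sup>D) x\<^sup>n\<close>. At \<open>x\<^sup>n\<^sup>-\<^sup>m\<close> only the offsets \<open>s \<le> m\<close>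
  contribute, since \<open>P\<^sub>n\<^sub>-\<^sub>s\<close> has degree \<open>n - s\<close>, and \<open>recurrence_coeff\<close> applies.
\<close>
lemma full_recurrence:
  fixes P :: "nat \<Rightarrow> complex poly"
  assumes deg: "\<And>n. degree (P n) = n"
    and cf: "\<And>n k. k \<le> n \<Longrightarrow> coeff (P n) (n - k) = delta_falling N c n k / fact k"
  shows "[:0, 1:] * P n = P (Suc n) + (\<Sum>s\<le>n. smult (alpha N c n s) (P (n - s)))"
proof (rule poly_eqI)
  fix i
  have high: "coeff (P k) j = 0" if "k < j" for k j
    using that deg by (simp add: coeff_eq_0)
  have lead: "coeff (P k) k = 1" for k using cf[of 0 k] by simp
  consider "i > Suc n" | "i = Suc n" | "i \<le> n" by linarith
  then show "coeff ([:0, 1:] * P n) i =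
      coeff (P (Suc n) + (\<Sum>s\<le>n. smult (alpha N c n s) (P (n - s)))) i"
  proof cases
    case 3
    define m where "m = n - i"
    have m: "i = n - m" "m \<le> n" using 3 by (auto simp: m_def)
    have "coeff ([:0, 1:] * P n) i = delta_falling N c n (Suc m) / fact (Suc m)"
    proof (cases i)
      case 0
      \<comment> \<open>A multiple of \<open>x\<close> has no constant term; on the other side \<open>\<delta>\<^sub>0 = 0\<close> is a factor.\<close>
      then have "n - m = 0" using m by simp
      then show ?thesis using 0 by (simp add: delta_falling_Suc)
    next
      case (Suc j)
      then have "j = n - Suc m" "Suc m \<le> n" using m by auto
      then show ?thesis using Suc cf[of "Suc m" n] by simp
    qed
    also have "\<dots> = delta_falling N c (Suc n) (Suc m) / fact (Suc m) +
        (\<Sum>s\<le>m. alpha N c n s * (delta_falling N c (n - s) (m - s) / fact (m - s)))"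
      by (rule recurrence_coeff) fact
    also have "delta_falling N c (Suc n) (Suc m) / fact (Suc m) = coeff (P (Suc n)) i"
      using cf[of "Suc m" "Suc n"] m by simp
    also have "(\<Sum>s\<le>m. alpha N c n s * (delta_falling N c (n - s) (m - s) / fact (m - s))) =
        (\<Sum>s\<le>m. alpha N c n s * coeff (P (n - s)) i)"
    proof (rule sum.cong[OF refl])
      fix s assume "s \<in> {..m}"
      then have "n - s - (m - s) = i" "m - s \<le> n - s" using m by auto
      then show "alpha N c n s * (delta_falling N c (n - s) (m - s) / fact (m - s)) =
          alpha N c n s * coeff (P (n - s)) i"
        using cf[of "m - s" "n - s"] by simp
    qed
    also have "\<dots> = (\<Sum>s\<le>n. alpha N c n s * coeff (P (n - s)) i)"
      by (rule sum.mono_neutral_left) (use m in \<open>auto intro!: high\<close>)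
    finally show ?thesis by (simp add: coeff_sum)
  qed (auto simp: coeff_sum high lead coeff_pCons split: nat.split)
qed

theorem theorem5:
  fixes N :: nat and c :: "nat \<Rightarrow> complex"
    and P :: "nat \<Rightarrow> complex poly" and lam :: "nat \<Rightarrow> complex"
  assumes "N \<ge> 1"
    and "\<And>n. degree (P n) = n"
    and "\<And>n. lead_coeff (P n) = 1"
    and "\<And>n. diff_op N c (P n) = smult (lam n) (P n)"
  shows "(\<forall>n::nat.
            (\<Sum>s=1..N - 1. smult (alpha N c n s) (extend_by_zero P (int n - int s)))
            + ([:alpha N c n 0:] - [:0, 1:]) * extend_by_zero P (int n)
            + extend_by_zero P (int n + 1) = 0)
         \<and> (\<forall>m\<in>{- int N + 1..-1}. extend_by_zero P m = 0)
         \<and> extend_by_zero P 0 = 1"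
proof (intro conjI allI ballI)
  fix n :: nat
  let ?t = "\<lambda>s. smult (alpha N c n s) (extend_by_zero P (int n - int s))"
  have inside: "extend_by_zero P (int n - int s) = P (n - s)" if "s \<le> n" for s
    using that by (simp add: extend_by_zero_def nat_diff_distrib)
  have vanish: "alpha N c n s = 0" if "N \<le> s" for s
    using that by (cases "s \<le> n") (simp_all add: alpha_altdiff altdiff_delta1, simp add: alpha_def)
  have outside: "alpha N c n s = 0" if "n < s" for s
    using that by (simp add: alpha_def)
  \<comment> \<open>As \<open>n\<close> may lie on either side of \<open>N - 1\<close>, both ranges are compared with their union.\<close>
  have "(\<Sum>s\<le>n. smult (alpha N c n s) (P (n - s))) = (\<Sum>s\<le>n. ?t s)"
    by (simp add: inside)
  also have "\<dots> = (\<Sum>s\<le>max n (N - 1). ?t s)"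
    by (rule sum.mono_neutral_left) (auto simp: outside)
  also have "\<dots> = (\<Sum>s\<in>{0..N - 1}. ?t s)"
    by (rule sum.mono_neutral_right) (auto simp: vanish)
  also have "\<dots> = ?t 0 + (\<Sum>s=1..N - 1. ?t s)"
    by (subst sum.atLeast_Suc_atMost) simp_all
  finally have "[:0, 1:] * P n =
      P (Suc n) + (smult (alpha N c n 0) (P n) + (\<Sum>s=1..N - 1. ?t s))"
    using full_recurrence[of P N c n] eigenpoly_coeff[OF assms(2-4)] assms(2)
    using inside[of 0] by simp
  moreover have "extend_by_zero P (int n + 1) = P (Suc n)" "extend_by_zero P (int n) = P n"
    by (simp_all add: extend_by_zero_def nat_add_distrib)
  ultimately show "(\<Sum>s=1..N - 1. ?t s) + ([:alpha N c n 0:] - [:0, 1:]) * extend_by_zero P (int n)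
            + extend_by_zero P (int n + 1) = 0"
    by (simp only: left_diff_distrib) simp
next
  fix m assume "m \<in> {- int N + 1..-1}"
  then show "extend_by_zero P m = 0" by (simp add: extend_by_zero_def)
next
  have "P 0 = [:lead_coeff (P 0):]"
    using assms(2)[of 0] by (metis degree_eq_zeroE lead_coeff_pCons(2))
  then show "extend_by_zero P 0 = 1"
    using assms(3)[of 0] by (simp add: extend_by_zero_def one_pCons)
qed

end
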